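(* Let $\alpha\in(0,1)$ and let $0=t_0<t_1<\cdots<t_N=T$ be an arbitrary grid. Let $A=(a_{n-j}^n)_{1\le j\le n\le N}$ be the array kernel with entries $$a_{n-j}^n=\frac{1}{\Gamma(\alpha)}\int_{t_{j-1}}^{t_j}(t_n-s)^{\alpha-1}\,ds .$$ Then $A$ is R-CMM. Consequently, for the scheme $u_n=u_0+\sum_{j=1}^n a_{n-j}^n f(t_j,u_j)$, $1\le n\le N$, the following hold. (1) If $f:[0,\infty)\times\mathbb{R}\to\mathbb{R}$ is smooth, $f(t,\cdot)$ is Lipschitz with constant $M>0$ uniformly in $t\in[0,T]$, and $M\sup_{1\le j\le N}a_0^j<1$, then two numerical solutions with initial values $u_0^{(1)}\ge u_0^{(2)}$ satisfy $u_n^{(1)}\ge u_n^{(2)}$ for all $n\le N$. (2) If $f(t,u)=f(u)$ is smooth with $|f'(u)|\le M$ for all $u$ for some $M>0$, and $M\sup_{1\le j\le N}a_0^j<1$, then the numerical solution $\{u_n\}$ is monotone for $0\le n\le N$ (i.e. $u_0,\dots,u_N$ is nondecreasing or nonincreasing).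
   Context: An array kernel $A=(a_{n-j}^n)_{1\le j\le n}$ is a lower triangular real array whose entry in row $n$ and column $j$ is $a_{n-j}^n$ (so $a_0^n$ are the diagonal entries). The pseudo-convolution $C=A\bar{*}B$ of two array kernels is $c_{n-k}^n=\sum_{j=k}^n a_{n-j}^n b_{j-k}^j$ for $1\le k\le n$ (the product of lower triangular matrices). Row $n$ of the product depends only on rows $\le n$, so all notions apply to finite arrays ($n\le N$). $L$ is the array kernel with all entries (on and below the diagonal) equal to $1$. The right complementary kernel $C_R$ of $A$ is the array kernel with $A\bar{*}C_R=L$. An array kernel $A=(a_{n-j}^n)$ is column monotone if its entries are nonnegative and $a_{j-1}^{n-1}\ge a_j^n$ for all $1\le j\le n-1$; it is row monotone if its entries are nonnegative and $a_{j-1}^n\ge a_j^n$ for all $1\le j\le n-1$; it is doubly monotone if it is both. $A$ is R-CMM (right complementary monotone) if $A$ is column monotone and $C_R$ exists and is doubly monotone. *)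

theory Defs
  imports "HOL-Analysis.Analysis"
begin

text \<open>
  An array kernel is a function \<open>A\<close> where \<open>A n m\<close> stands for \<open>a\<^sub>m\<^sup>n\<close>, so that the entry in
  row \<open>n\<close> and column \<open>j\<close> is \<open>A n (n - j)\<close>.  All notions below are relative to the
  finite index range \<open>1 \<le> j \<le> n \<le> N\<close>; values of \<open>A\<close> outside of it are never inspected.
\<close>

type_synonym array_kernel = "nat \<Rightarrow> nat \<Rightarrow> real"

definition pseudo_conv :: "array_kernel \<Rightarrow> array_kernel \<Rightarrow> array_kernel" where
  "pseudo_conv A B = (\<lambda>n m. \<Sum>j = n - m..n. A n (n - j) * B j (j - (n - m)))"

text \<open>The column index \<open>k\<close> in \<open>c\<^sub>n\<^sub>-\<^sub>k\<^sup>n\<close> is recovered above as \<open>n - m\<close>:\<close>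

lemma pseudo_conv_entry:
  assumes "1 \<le> k" "k \<le> n"
  shows "pseudo_conv A B n (n - k) = (\<Sum>j = k..n. A n (n - j) * B j (j - k))"
  using assms by (simp add: pseudo_conv_def)

definition L_kernel :: array_kernel where
  "L_kernel = (\<lambda>n m. 1)"

text \<open>
  Since \<open>L_kernel\<close> is an invertible triangular matrix, \<open>A\<close> is invertible whenever such a \<open>C\<close>
  exists, hence \<open>C\<close> is unique on the index range.
\<close>

definition right_complementary :: "nat \<Rightarrow> array_kernel \<Rightarrow> array_kernel \<Rightarrow> bool" where
  "right_complementary N A C \<longleftrightarrow>
    (\<forall>n k. 1 \<le> k \<and> k \<le> n \<and> n \<le> N \<longrightarrow> pseudo_conv A C n (n - k) = L_kernel n (n - k))"

definition nonneg_kernel :: "nat \<Rightarrow> array_kernel \<Rightarrow> bool" where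
  "nonneg_kernel N A \<longleftrightarrow> (\<forall>n j. 1 \<le> j \<and> j \<le> n \<and> n \<le> N \<longrightarrow> 0 \<le> A n (n - j))"

definition column_monotone :: "nat \<Rightarrow> array_kernel \<Rightarrow> bool" where
  "column_monotone N A \<longleftrightarrow> nonneg_kernel N A \<and>
    (\<forall>n j. n \<le> N \<and> 1 \<le> j \<and> j \<le> n - 1 \<longrightarrow> A (n - 1) (j - 1) \<ge> A n j)"

definition row_monotone :: "nat \<Rightarrow> array_kernel \<Rightarrow> bool" where
  "row_monotone N A \<longleftrightarrow> nonneg_kernel N A \<and>
    (\<forall>n j. n \<le> N \<and> 1 \<le> j \<and> j \<le> n - 1 \<longrightarrow> A n (j - 1) \<ge> A n j)"

definition doubly_monotone :: "nat \<Rightarrow> array_kernel \<Rightarrow> bool" where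
  "doubly_monotone N A \<longleftrightarrow> column_monotone N A \<and> row_monotone N A"

definition R_CMM :: "nat \<Rightarrow> array_kernel \<Rightarrow> bool" where
  "R_CMM N A \<longleftrightarrow> column_monotone N A \<and> (\<exists>C. right_complementary N A C \<and> doubly_monotone N C)"

text \<open>
  \<open>C\<^sup>k\<close> and \<open>C\<^sup>\<infinity>\<close> regularity on a set \<open>S\<close>.  Derivatives are taken within \<open>S\<close>, i.e. one-sided at
  boundary points; on the sets used here (the half-plane and the line) they are unique.
\<close>

fun Ck_on :: "nat \<Rightarrow> ('a::real_normed_vector \<Rightarrow> real) \<Rightarrow> 'a set \<Rightarrow> bool" where
  "Ck_on 0 f S \<longleftrightarrow> continuous_on S f"
| "Ck_on (Suc k) f S \<longleftrightarrow>
    (\<exists>f'. (\<forall>x\<in>S. (f has_derivative f' x) (at x within S)) \<and> (\<forall>v. Ck_on k (\<lambda>x. f' x v) S))"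

definition smooth_on :: "('a::real_normed_vector \<Rightarrow> real) \<Rightarrow> 'a set \<Rightarrow> bool" where
  "smooth_on f S \<longleftrightarrow> (\<forall>k. Ck_on k f S)"

definition numerical_solution ::
  "nat \<Rightarrow> array_kernel \<Rightarrow> (nat \<Rightarrow> real) \<Rightarrow> (real \<Rightarrow> real \<Rightarrow> real) \<Rightarrow> (nat \<Rightarrow> real) \<Rightarrow> bool" where
  "numerical_solution N A t f u \<longleftrightarrow>
    (\<forall>n. 1 \<le> n \<and> n \<le> N \<longrightarrow> u n = u 0 + (\<Sum>j = 1..n. A n (n - j) * f (t j) (u j)))"

end

theory Submission
  imports Defs
begin

text \<open>
  Write \<open>a\<^sub>n\<^sub>j\<close> for the entry of \<open>A\<close> in row \<open>n\<close> and column \<open>j\<close>.  Up to a positive factor,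
  \<open>a\<^sub>n\<^sub>j\<close> is the increment of a power function, \<open>(t\<^sub>n - t\<^sub>j\<^sub>-\<^sub>1)\<^sup>\<alpha> - (t\<^sub>n - t\<^sub>j)\<^sup>\<alpha>\<close>.

  Monotonicity of \<open>C\<close> with \<open>A C = L\<close> is a sign property of inverse matrices.  By uniqueness of
  triangular systems, the differences of \<open>C\<close> along rows are minus the subdiagonal entries of
  \<open>A\<inverse>\<close>.  The differences along columns are the entries of \<open>W\<inverse>\<close>, where the matrix \<open>W\<close> consists
  of the differences of consecutive rows of \<open>A L\<close>; this is because the column of \<open>C\<close> is the
  running sum of its differences, and \<open>L\<close> is the summation operator.  Both inverses have
  nonpositive entries below the diagonal by Kaluza's argument (\<open>kaluza_sign\<close>), which for matrices
  that are not Toeplitz needs that the quotients of consecutive rows decrease from left to right.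
  The entries of \<open>A L\<close> are telescoping sums, so \<open>w\<^sub>n\<^sub>j\<close> is, up to the same factor,
  \<open>(t\<^sub>n - t\<^sub>j\<^sub>-\<^sub>1)\<^sup>\<alpha> - (t\<^sub>n\<^sub>-\<^sub>1 - t\<^sub>j\<^sub>-\<^sub>1)\<^sup>\<alpha>\<close>: again an increment of a power function, in
  the other time variable.  Both quotient conditions are therefore instances of one inequality
  for such increments (\<open>powr_increment_cross\<close>), which a mean value argument reduces to the
  monotonicity of \<open>\<xi> \<mapsto> (\<xi> - p) / (\<xi> - q)\<close>.

  For the scheme, multiplying by \<open>C\<close> turns \<open>u\<^sub>n = u\<^sub>0 + \<Sum> a\<^sub>n\<^sub>j g\<^sub>j\<close> into the difference form
  \<open>g\<^sub>n = \<Sum> c\<^sub>n\<^sub>j (u\<^sub>j - u\<^sub>j\<^sub>-\<^sub>1)\<close> (\<open>volterra_to_difference_form\<close>).  Applied to the difference of two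
  solutions and summed by parts, row monotonicity of \<open>C\<close> makes the coefficients of all earlier
  values have the sign that propagates nonnegativity.  Subtracting the identities for \<open>n\<close> and
  \<open>n - 1\<close> instead, column monotonicity does the same for the increments of a single solution.
  The implicit term is controlled by \<open>c\<^sub>n\<^sub>n = 1 / a\<^sub>n\<^sub>n > M\<close>.
\<close>

section \<open>Triangular systems\<close>

lemma triangular_system_solvable:
  fixes a :: "nat \<Rightarrow> nat \<Rightarrow> real"
  assumes "\<And>n. k \<le> n \<Longrightarrow> n \<le> N \<Longrightarrow> a n n \<noteq> 0"
  shows "\<exists>x. \<forall>n. k \<le> n \<and> n \<le> N \<longrightarrow> (\<Sum>j = k..n. a n j * x j) = y n"
  using assms
proof (induction N)
  case 0
  show ?case
  proof (intro exI allI impI)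
    fix n assume n: "k \<le> n \<and> n \<le> 0"
    then have "n = 0" "k = 0" by auto
    then show "(\<Sum>j = k..n. a n j * (y 0 / a 0 0)) = y n"
      using 0 by simp
  qed
next
  case (Suc N)
  then obtain x where x: "\<And>n. k \<le> n \<Longrightarrow> n \<le> N \<Longrightarrow> (\<Sum>j = k..n. a n j * x j) = y n"
    by force
  show ?case
  proof (cases "k \<le> Suc N")
    case False
    then show ?thesis by auto
  next
    case True
    define z where "z = (y (Suc N) - (\<Sum>j = k..N. a (Suc N) j * x j)) / a (Suc N) (Suc N)"
    let ?x = "x(Suc N := z)"
    have old: "(\<Sum>j = k..m. a n j * ?x j) = (\<Sum>j = k..m. a n j * x j)" if "m \<le> N" for n m
      using that by (intro sum.cong) auto
    have "(\<Sum>j = k..n. a n j * ?x j) = y n" if "k \<le> n" "n \<le> Suc N" for n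
    proof (cases "n = Suc N")
      case True
      have "(\<Sum>j = k..Suc N. a (Suc N) j * ?x j)
          = (\<Sum>j = k..N. a (Suc N) j * ?x j) + a (Suc N) (Suc N) * z"
        using \<open>k \<le> Suc N\<close> by simp
      also have "\<dots> = y (Suc N)"
        using old[of N "Suc N"] Suc.prems[of "Suc N"] \<open>k \<le> Suc N\<close>
        by (simp add: z_def)
      finally show ?thesis using True by simp
    next
      case False
      then show ?thesis using old[of n n] x[of n] that by simp
    qed
    then show ?thesis by blast
  qed
qed

lemma triangular_system_unique:
  fixes a :: "nat \<Rightarrow> nat \<Rightarrow> real"
  assumes diag: "\<And>n. k \<le> n \<Longrightarrow> n \<le> N \<Longrightarrow> a n n \<noteq> 0"
    and eq: "\<And>n. k \<le> n \<Longrightarrow> n \<le> N \<Longrightarrow> (\<Sum>j = k..n. a n j * x j) = (\<Sum>j = k..n. a n j * y j)"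
    and "k \<le> n" "n \<le> N"
  shows "x n = y n"
  using assms(3,4)
proof (induction n rule: less_induct)
  case (less n)
  have split: "(\<Sum>j = k..n. a n j * z j) = a n n * z n + (\<Sum>j = k..<n. a n j * z j)" for z
    using less.prems by (simp add: sum.last_plus)
  have "(\<Sum>j = k..<n. a n j * x j) = (\<Sum>j = k..<n. a n j * y j)"
    using less by (intro sum.cong) auto
  then show ?case
    using eq[OF less.prems] diag[OF less.prems] by (simp add: split)
qed

section \<open>Kaluza's sign argument\<close>

text \<open>
  Scale row \<open>m\<close> of \<open>W\<close> so that it agrees with row \<open>m + 1\<close> in column \<open>k\<close>.  The quotient condition
  then makes it dominate row \<open>m + 1\<close> in the columns after \<open>k\<close>, where \<open>x\<close> is nonpositive by
  induction.  Hence replacing row \<open>m\<close> by the first entries of row \<open>m + 1\<close> can only increase the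
  sum, which is \<open>0\<close> (for \<open>m = k\<close> it is a positive multiple of \<open>x k\<close>), and the remaining term \<open>W (m + 1) (m + 1) * x (m + 1)\<close> has to compensate.
\<close>

lemma kaluza_sign:
  fixes W :: "nat \<Rightarrow> nat \<Rightarrow> real"
  assumes pos: "\<And>n j. k \<le> j \<Longrightarrow> j \<le> n \<Longrightarrow> n \<le> N \<Longrightarrow> 0 < W n j"
    and ratio: "\<And>n j. k \<le> j \<Longrightarrow> j < n \<Longrightarrow> n < N \<Longrightarrow>
      W (Suc n) (Suc j) * W n j \<le> W (Suc n) j * W n (Suc j)"
    and start: "0 \<le> x k"
    and zero: "\<And>n. k < n \<Longrightarrow> n \<le> N \<Longrightarrow> (\<Sum>j = k..n. W n j * x j) = 0"
    and "k < n" "n \<le> N"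
  shows "x n \<le> 0"
  using assms(5,6)
proof (induction n rule: less_induct)
  case (less n)
  then obtain m where m: "n = Suc m" "k \<le> m" "m < N"
    by (cases n) auto
  \<comment> \<open>The quotient condition between neighbouring columns, chained from column \<open>k\<close> to column \<open>j\<close>.\<close>
  have ratio_k: "W (Suc m) j * W m k \<le> W (Suc m) k * W m j" if "k \<le> j" "j \<le> m" for j
    using that
  proof (induction j rule: dec_induct)
    case base
    then show ?case by simp
  next
    case (step j)
    have "W (Suc m) (Suc j) * W m k * W m j = (W (Suc m) (Suc j) * W m j) * W m k"
      by simp
    also have "\<dots> \<le> (W (Suc m) j * W m (Suc j)) * W m k"
      using ratio[of j m] pos[of k m] step m by (intro mult_right_mono) auto
    also have "\<dots> = (W (Suc m) j * W m k) * W m (Suc j)"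
      by simp
    also have "\<dots> \<le> (W (Suc m) k * W m j) * W m (Suc j)"
      using pos[of "Suc j" m] step m by (intro mult_right_mono) auto
    finally have "W (Suc m) (Suc j) * W m k * W m j \<le> (W (Suc m) k * W m (Suc j)) * W m j"
      by (simp add: mult_ac)
    then show ?case
      using pos[of j m] step m by simp
  qed
  have "0 \<le> (\<Sum>j = k..m. W (Suc m) j * x j)"
  proof (cases "m = k")
    case True
    then show ?thesis using start pos[of k "Suc m"] m by simp
  next
    case False
    have "0 \<le> (\<Sum>j = k..m. (W (Suc m) j * W m k - W (Suc m) k * W m j) * x j)"
    proof (intro sum_nonneg)
      fix j assume j: "j \<in> {k..m}"
      show "0 \<le> (W (Suc m) j * W m k - W (Suc m) k * W m j) * x j"
      proof (cases "j = k")
        case False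
        then show ?thesis
          using less.IH[of j] ratio_k[of j] j m by (intro mult_nonpos_nonpos) auto
      qed simp
    qed
    also have "\<dots> = W m k * (\<Sum>j = k..m. W (Suc m) j * x j) - W (Suc m) k * (\<Sum>j = k..m. W m j * x j)"
      by (simp add: sum_distrib_left sum_subtractf[symmetric] algebra_simps)
    also have "(\<Sum>j = k..m. W m j * x j) = 0"
      using zero[of m] False m by simp
    finally show ?thesis
      using pos[of k m] m by (simp add: zero_le_mult_iff)
  qed
  moreover have "(\<Sum>j = k..m. W n j * x j) + W n n * x n = 0"
    using zero[of n] m less.prems by simp
  ultimately have "W n n * x n \<le> 0" using m by simp
  then show ?case
    using pos[of n n] less.prems by (simp add: mult_le_0_iff)
qed

section \<open>A criterion for right complementary monotonicity\<close>

lemma right_complementaryD: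
  assumes "right_complementary N A C" "1 \<le> k" "k \<le> n" "n \<le> N"
  shows "(\<Sum>j = k..n. A n (n - j) * C j (j - k)) = 1"
  using assms by (simp add: right_complementary_def pseudo_conv_entry L_kernel_def)

lemma right_complementary_exists:
  assumes "\<And>n. 1 \<le> n \<Longrightarrow> n \<le> N \<Longrightarrow> A n 0 \<noteq> 0"
  shows "\<exists>C. right_complementary N A C"
proof -
  have "\<forall>k. \<exists>x. 1 \<le> k \<longrightarrow> (\<forall>n. k \<le> n \<and> n \<le> N \<longrightarrow> (\<Sum>j = k..n. A n (n - j) * x j) = 1)"
    using triangular_system_solvable[of _ N "\<lambda>n j. A n (n - j)" "\<lambda>_. 1"] assms by auto
  from choice[OF this] obtain x where
    x: "\<forall>k. 1 \<le> k \<longrightarrow> (\<forall>n. k \<le> n \<and> n \<le> N \<longrightarrow> (\<Sum>j = k..n. A n (n - j) * x k j) = 1)" ..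
  \<comment> \<open>A kernel is indexed by its distance from the diagonal, so column \<open>k\<close> of row \<open>j\<close> is
    recovered as \<open>j - (j - k)\<close>.\<close>
  have "(\<Sum>j = k..n. A n (n - j) * x (j - (j - k)) j) = 1" if "1 \<le> k" "k \<le> n" "n \<le> N" for k n
  proof -
    have "(\<Sum>j = k..n. A n (n - j) * x (j - (j - k)) j) = (\<Sum>j = k..n. A n (n - j) * x k j)"
      by (intro sum.cong) auto
    then show ?thesis using x that by simp
  qed
  then have "right_complementary N A (\<lambda>n m. x (n - m) n)"
    by (auto simp: right_complementary_def pseudo_conv_entry L_kernel_def)
  then show ?thesis by blast
qed

lemma triangular_sum_swap:
  fixes f :: "nat \<Rightarrow> nat \<Rightarrow> real"
  shows "(\<Sum>j = k..n. \<Sum>i = k..j. f i j) = (\<Sum>i = k..n. \<Sum>j = i..n. f i j)"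
proof -
  have "(\<Sum>j = k..n. \<Sum>i = k..j. f i j) = (\<Sum>(j, i)\<in>(SIGMA j:{k..n}. {k..j}). f i j)"
    by (simp add: sum.Sigma)
  also have "\<dots> = (\<Sum>(i, j)\<in>(SIGMA i:{k..n}. {i..n}). f i j)"
    by (rule sum.reindex_bij_witness[of _ prod.swap prod.swap]) auto
  also have "\<dots> = (\<Sum>i = k..n. \<Sum>j = i..n. f i j)"
    by (simp add: sum.Sigma)
  finally show ?thesis .
qed

lemma column_monotoneD:
  assumes "column_monotone N A" "1 \<le> k" "k \<le> n" "n < N"
  shows "A (Suc n) (Suc n - k) \<le> A n (n - k)"
proof -
  have "1 \<le> Suc n - k \<and> Suc n - k \<le> Suc n - 1"
    using assms by arith
  then have "A (Suc n) (Suc n - k) \<le> A (Suc n - 1) (Suc n - k - 1)"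
    using assms(1)[unfolded column_monotone_def, THEN conjunct2, rule_format, of "Suc n" "Suc n - k"] assms
    by auto
  then show ?thesis by simp
qed

lemma row_monotoneD:
  assumes "row_monotone N A" "1 \<le> k" "k < n" "n \<le> N"
  shows "A n (n - k) \<le> A n (n - Suc k)"
proof -
  have "1 \<le> n - k \<and> n - k \<le> n - 1"
    using assms by arith
  then have "A n (n - k) \<le> A n (n - k - 1)"
    using assms(1)[unfolded row_monotone_def, THEN conjunct2, rule_format, of n "n - k"] assms
    by auto
  then show ?thesis by simp
qed

lemma sum_by_parts_tail:
  fixes p d :: "nat \<Rightarrow> real"
  shows "(\<Sum>j = k..n. p j * (\<Sum>i = k..j. d i)) = (\<Sum>i = k..n. (\<Sum>j = i..n. p j) * d i)"
proof -
  have "(\<Sum>j = k..n. p j * (\<Sum>i = k..j. d i)) = (\<Sum>j = k..n. \<Sum>i = k..j. p j * d i)"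
    by (simp add: sum_distrib_left)
  also have "\<dots> = (\<Sum>i = k..n. \<Sum>j = i..n. p j * d i)"
    by (rule triangular_sum_swap)
  finally show ?thesis by (simp add: sum_distrib_right)
qed

text \<open>
  For convolution kernels both conditions on quotients hold as soon as the sequence is
  log-convex: there the differences of \<open>C\<close> along rows and along columns are the same numbers.  On
  a nonuniform grid they differ, and the column differences need the second matrix \<open>W\<close>, whose row
  \<open>n\<close> is the difference of rows \<open>n\<close> and \<open>n - 1\<close> of \<open>A L\<close>; in column \<open>n\<close> the subtracted sum is
  empty, as it should be.
\<close>

theorem R_CMM_if_log_convex:
  assumes col: "column_monotone N A"
    and pos: "\<And>n j. 1 \<le> j \<Longrightarrow> j \<le> n \<Longrightarrow> n \<le> N \<Longrightarrow> 0 < A n (n - j)"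
    and ratio: "\<And>n j. 1 \<le> j \<Longrightarrow> j < n \<Longrightarrow> n < N \<Longrightarrow>
      A (Suc n) (n - j) * A n (n - j) \<le> A (Suc n) (Suc n - j) * A n (n - Suc j)"
    and W: "\<And>n j. W n j = (\<Sum>i = j..n. A n (n - i)) - (\<Sum>i = j..n - 1. A (n - 1) (n - 1 - i))"
    and W_pos: "\<And>n j. 1 \<le> j \<Longrightarrow> j \<le> n \<Longrightarrow> n \<le> N \<Longrightarrow> 0 < W n j"
    and W_ratio: "\<And>n j. 1 \<le> j \<Longrightarrow> j < n \<Longrightarrow> n < N \<Longrightarrow>
      W (Suc n) (Suc j) * W n j \<le> W (Suc n) j * W n (Suc j)"
  shows "R_CMM N A"
proof -
  have "A n 0 \<noteq> 0" if "1 \<le> n" "n \<le> N" for n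
    using pos[of n n] that by simp
  from right_complementary_exists[of N A, OF this] obtain C where C: "right_complementary N A C"
    by blast
  note AC = right_complementaryD[OF C]
  \<comment> \<open>By column monotonicity the terms before the diagonal add up to at most \<open>1\<close>, the value of
    the full sum in the row above; so the diagonal term is nonnegative.\<close>
  have nonneg: "0 \<le> C n (n - k)" if k: "1 \<le> k" "k \<le> n" "n \<le> N" for n k
    using k(2,3)
  proof (induction n rule: less_induct)
    case (less n)
    have "(\<Sum>j = k..<n. A n (n - j) * C j (j - k)) \<le> 1"
    proof (cases "n = k")
      case False
      then obtain m where m: "n = Suc m" "k \<le> m" using less.prems by (cases n) auto
      have "(\<Sum>j = k..m. A n (n - j) * C j (j - k)) \<le> (\<Sum>j = k..m. A m (m - j) * C j (j - k))"
      proof (intro sum_mono mult_right_mono)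
        fix j assume j: "j \<in> {k..m}"
        show "A n (n - j) \<le> A m (m - j)"
          using column_monotoneD[OF col, of j m] j k m less.prems by auto
        show "0 \<le> C j (j - k)" using less j m by auto
      qed
      also have "\<dots> = 1" using AC[of k m] k m less.prems by simp
      finally show ?thesis using m by (simp add: atLeastLessThanSuc_atLeastAtMost)
    qed simp
    moreover have "A n 0 * C n (n - k) + (\<Sum>j = k..<n. A n (n - j) * C j (j - k)) = 1"
      using AC[of k n] k less.prems by (simp add: sum.last_plus)
    ultimately have "0 \<le> A n 0 * C n (n - k)" by linarith
    then show ?case using pos[of n n] k less.prems by (simp add: zero_le_mult_iff)
  qed
  have row: "C n (n - k) \<le> C n (n - Suc k)" if k: "1 \<le> k" "k < n" "n \<le> N" for n k
  proof -
    \<comment> \<open>Column \<open>k\<close> of \<open>C\<close> minus column \<open>k + 1\<close>, the latter extended by zero above the diagonal;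
      this is column \<open>k\<close> of the inverse of \<open>A\<close>.\<close>
    define x where "x j = C j (j - k) - (if j = k then 0 else C j (j - Suc k))" for j
    have "x n \<le> 0"
    proof (rule kaluza_sign[where W = "\<lambda>n j. A n (n - j)" and k = k and N = N and n = n])
      show "0 \<le> x k" using nonneg[of k k] k by (simp add: x_def)
      show "(\<Sum>j = k..n. A n (n - j) * x j) = 0" if n: "k < n" "n \<le> N" for n
      proof -
        have "(\<Sum>j = k..n. A n (n - j) * x j) = A n (n - k) * x k + (\<Sum>j = Suc k..n. A n (n - j) * x j)"
          using n by (simp add: sum.atLeast_Suc_atMost)
        also have "(\<Sum>j = Suc k..n. A n (n - j) * x j)
            = (\<Sum>j = Suc k..n. A n (n - j) * C j (j - k)) - (\<Sum>j = Suc k..n. A n (n - j) * C j (j - Suc k))"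
          unfolding sum_subtractf[symmetric]
          by (intro sum.cong) (auto simp: x_def algebra_simps)
        also have "(\<Sum>j = Suc k..n. A n (n - j) * C j (j - Suc k)) = 1"
          using AC[of "Suc k" n] n by simp
        also have "A n (n - k) * x k + ((\<Sum>j = Suc k..n. A n (n - j) * C j (j - k)) - 1)
           = (\<Sum>j = k..n. A n (n - j) * C j (j - k)) - 1"
          using n by (simp add: sum.atLeast_Suc_atMost x_def)
        finally show ?thesis using AC[of k n] k n by simp
      qed
    qed (use k pos ratio in auto)
    then show ?thesis using k by (simp add: x_def)
  qed
  have column: "C n (n - k) \<le> C (n - 1) (n - 1 - k)" if k: "1 \<le> k" "k < n" "n \<le> N" for n k
  proof -
    \<comment> \<open>The increments of column \<open>k\<close>, which starts from the value zero above the diagonal.\<close>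
    define d where "d j = C j (j - k) - (if j = k then 0 else C (j - 1) (j - 1 - k))" for j
    have d_sum: "(\<Sum>i = k..j. d i) = C j (j - k)" if "k \<le> j" for j
      using that by (induction j rule: dec_induct) (auto simp: d_def)
    \<comment> \<open>The equation \<open>A C = L\<close>, written for \<open>d\<close>: its matrix is \<open>A L\<close>.  Its consecutive
      differences give the homogeneous system with matrix \<open>W\<close>.\<close>
    have S: "(\<Sum>i = k..n. (\<Sum>j = i..n. A n (n - j)) * d i) = 1" if "k \<le> n" "n \<le> N" for n
    proof -
      have "(\<Sum>i = k..n. (\<Sum>j = i..n. A n (n - j)) * d i) = (\<Sum>j = k..n. A n (n - j) * (\<Sum>i = k..j. d i))"
        by (rule sum_by_parts_tail[symmetric])
      also have "\<dots> = (\<Sum>j = k..n. A n (n - j) * C j (j - k))"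
        by (intro sum.cong) (auto simp: d_sum)
      finally show ?thesis using AC[of k n] k that by simp
    qed
    have "d n \<le> 0"
    proof (rule kaluza_sign[where W = W and k = k and N = N and n = n])
      show "0 \<le> d k" using nonneg[of k k] k by (simp add: d_def)
      show "(\<Sum>j = k..n. W n j * d j) = 0" if n: "k < n" "n \<le> N" for n
      proof -
        obtain m where m: "n = Suc m" "k \<le> m" using n by (cases n) auto
        have "(\<Sum>j = k..n. W n j * d j) = (\<Sum>j = k..n. (\<Sum>i = j..n. A n (n - i)) * d j)
            - (\<Sum>j = k..n. (\<Sum>i = j..m. A m (m - i)) * d j)"
          using m by (simp only: W sum_subtractf[symmetric]) (simp add: algebra_simps)
        also have "(\<Sum>j = k..n. (\<Sum>i = j..m. A m (m - i)) * d j)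
            = (\<Sum>j = k..m. (\<Sum>i = j..m. A m (m - i)) * d j)"
          using m by simp
        finally show ?thesis using S[of n] S[of m] n m by simp
      qed
    qed (use k W_pos W_ratio in auto)
    then show ?thesis using k by (simp add: d_def)
  qed
  have nn: "nonneg_kernel N C"
    using nonneg by (auto simp: nonneg_kernel_def)
  have "column_monotone N C"
    unfolding column_monotone_def
  proof (intro conjI nn allI impI)
    fix n j assume j: "n \<le> N \<and> 1 \<le> j \<and> j \<le> n - 1"
    then have "n - (n - j) = j" "n - 1 - (n - j) = j - 1" by auto
    with column[of "n - j" n] j show "C n j \<le> C (n - 1) (j - 1)" by auto
  qed
  moreover have "row_monotone N C"
    unfolding row_monotone_def
  proof (intro conjI nn allI impI)
    fix n j assume j: "n \<le> N \<and> 1 \<le> j \<and> j \<le> n - 1"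
    then have "n - (n - j) = j" "n - Suc (n - j) = j - 1" by auto
    with row[of "n - j" n] j show "C n j \<le> C n (j - 1)" by auto
  qed
  ultimately show ?thesis
    using C col by (auto simp: R_CMM_def doubly_monotone_def)
qed

section \<open>Schemes with an R-CMM kernel\<close>

text \<open>
  Multiplying the right-hand side by \<open>A\<close> gives \<open>A C = L\<close> applied to the increments of \<open>u\<close>, which
  telescopes to \<open>u n - u 0\<close>.  As \<open>A\<close> is injective, this identifies \<open>g\<close>.
\<close>

lemma volterra_to_difference_form:
  assumes C: "right_complementary N A C"
    and u: "\<And>n. 1 \<le> n \<Longrightarrow> n \<le> N \<Longrightarrow> u n = u 0 + (\<Sum>j = 1..n. A n (n - j) * g j)"
    and n: "1 \<le> n" "n \<le> N"
  shows "g n = (\<Sum>j = 1..n. C n (n - j) * (u j - u (j - 1)))"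
proof (rule triangular_system_unique[where a = "\<lambda>n j. A n (n - j)" and k = 1 and N = N])
  show "A n (n - n) \<noteq> 0" if "1 \<le> n" "n \<le> N" for n
    using right_complementaryD[OF C, of n n] that by auto
  show "(\<Sum>j = 1..n. A n (n - j) * g j)
      = (\<Sum>j = 1..n. A n (n - j) * (\<Sum>i = 1..j. C j (j - i) * (u i - u (i - 1))))"
    if "1 \<le> n" "n \<le> N" for n
  proof -
    have "(\<Sum>j = 1..n. A n (n - j) * (\<Sum>i = 1..j. C j (j - i) * (u i - u (i - 1))))
        = (\<Sum>i = 1..n. \<Sum>j = i..n. A n (n - j) * (C j (j - i) * (u i - u (i - 1))))"
      unfolding sum_distrib_left by (rule triangular_sum_swap)
    also have "\<dots> = (\<Sum>i = 1..n. (\<Sum>j = i..n. A n (n - j) * C j (j - i)) * (u i - u (i - 1)))"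
      by (simp add: sum_distrib_right mult.assoc)
    also have "\<dots> = (\<Sum>i = 1..n. u i - u (i - 1))"
      using right_complementaryD[OF C] that by (intro sum.cong) auto
    also have "\<dots> = u n - u 0"
      using that(1) by (induction n rule: dec_induct) auto
    finally show ?thesis using u[OF that] by simp
  qed
qed (use n in auto)

lemma diagonal_dominates:
  assumes C: "right_complementary N A C" and nn: "nonneg_kernel N C"
    and n: "1 \<le> n" "n \<le> N" and M: "M * A n 0 < 1"
  shows "M < C n 0"
proof -
  have AC: "A n 0 * C n 0 = 1"
    using right_complementaryD[OF C, of n n] n by simp
  have "0 \<le> C n (n - n)"
    using nn n unfolding nonneg_kernel_def by blast
  with AC have "0 < C n 0" by (cases "C n 0 = 0") auto
  have "M = (M * A n 0) * C n 0" using AC by simp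
  also have "\<dots> < 1 * C n 0" using M \<open>0 < C n 0\<close> by (rule mult_strict_right_mono)
  finally show ?thesis by simp
qed

text \<open>
  One step of the implicit scheme: \<open>g\<close> is a Lipschitz image of the unknown \<open>x\<close>, and \<open>c\<close> the
  diagonal entry of \<open>C\<close>.  Were \<open>x\<close> negative, \<open>g\<close> would be too small in size to compensate
  \<open>c * x\<close>.
\<close>

lemma implicit_step_sign:
  fixes x g c M :: real
  assumes "\<bar>g\<bar> \<le> M * \<bar>x\<bar>" "M < c" "0 \<le> c * x - g"
  shows "0 \<le> x"
proof (rule ccontr)
  assume "\<not> 0 \<le> x"
  then have "c * x < M * x" using assms(2) by (simp add: mult_less_cancel_right)
  moreover have "M * x \<le> g" using assms(1) \<open>\<not> 0 \<le> x\<close> by (auto simp: abs_if split: if_splits)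
  ultimately show False using assms(3) by linarith
qed

lemma sum_by_parts_difference:
  fixes c u :: "nat \<Rightarrow> real"
  assumes "1 \<le> n"
  shows "(\<Sum>j = 1..n. c j * (u j - u (j - 1)))
    = c n * u n - c 1 * u 0 - (\<Sum>j = 1..<n. (c (Suc j) - c j) * u j)"
  using assms by (induction n rule: dec_induct) (auto simp: algebra_simps)

text \<open>
  In the difference form for \<open>e = u - v\<close>, summation by parts leaves \<open>C n 0 * e n\<close> on one side, and
  on the other side only earlier values of \<open>e\<close>, with weights that are nonnegative by row
  monotonicity and by \<open>C \<ge> 0\<close>.
\<close>

theorem R_CMM_comparison:
  assumes A: "R_CMM N A"
    and u: "numerical_solution N A t f u" and v: "numerical_solution N A t f v"
    and init: "v 0 \<le> u 0"
    and lip: "\<And>n x y. 1 \<le> n \<Longrightarrow> n \<le> N \<Longrightarrow> \<bar>f (t n) x - f (t n) y\<bar> \<le> M * \<bar>x - y\<bar>"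
    and M: "\<And>n. 1 \<le> n \<Longrightarrow> n \<le> N \<Longrightarrow> M * A n 0 < 1"
    and n: "n \<le> N"
  shows "v n \<le> u n"
proof -
  obtain C where C: "right_complementary N A C" and nn: "nonneg_kernel N C"
    and row: "row_monotone N C"
    using A by (auto simp: R_CMM_def doubly_monotone_def row_monotone_def)
  define e where "e j = u j - v j" for j
  define g where "g j = f (t j) (u j) - f (t j) (v j)" for j
  have e: "e n = e 0 + (\<Sum>j = 1..n. A n (n - j) * g j)" if n: "1 \<le> n" "n \<le> N" for n
  proof -
    have "u n = u 0 + (\<Sum>j = 1..n. A n (n - j) * f (t j) (u j))"
      and "v n = v 0 + (\<Sum>j = 1..n. A n (n - j) * f (t j) (v j))"
      using u v n by (auto simp: numerical_solution_def)
    then show ?thesis by (simp add: e_def g_def right_diff_distrib sum_subtractf)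
  qed
  have "0 \<le> e n"
    using n
  proof (induction n rule: less_induct)
    case (less n)
    show ?case
    proof (cases "n = 0")
      case True
      then show ?thesis using init by (simp add: e_def)
    next
      case False
      then have n: "1 \<le> n" "n \<le> N" using less.prems by auto
      have "g n = C n (n - n) * e n - C n (n - 1) * e 0
          - (\<Sum>j = 1..<n. (C n (n - Suc j) - C n (n - j)) * e j)"
        using volterra_to_difference_form[OF C e n] sum_by_parts_difference[OF n(1), of "\<lambda>j. C n (n - j)" e]
        by simp
      moreover have "0 \<le> (\<Sum>j = 1..<n. (C n (n - Suc j) - C n (n - j)) * e j)"
      proof (intro sum_nonneg mult_nonneg_nonneg)
        fix j assume j: "j \<in> {1..<n}"
        show "0 \<le> C n (n - Suc j) - C n (n - j)"
          using row_monotoneD[OF row, of j n] n j by auto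
        show "0 \<le> e j" using less.IH j n by auto
      qed
      moreover have "0 \<le> C n (n - 1) * e 0"
        using nn n init unfolding nonneg_kernel_def e_def by (intro mult_nonneg_nonneg) auto
      ultimately have "0 \<le> C n 0 * e n - g n" by simp
      moreover have "\<bar>g n\<bar> \<le> M * \<bar>e n\<bar>"
        using lip[OF n] by (simp add: g_def e_def)
      ultimately show ?thesis
        using implicit_step_sign diagonal_dominates[OF C nn n M[OF n]] by blast
    qed
  qed
  then show ?thesis by (simp add: e_def)
qed

text \<open>
  The difference of the identities for rows \<open>n\<close> and \<open>n - 1\<close> expresses the new increment, up to the
  implicit term, through the previous ones; their weights are the decrements of the columns of
  \<open>C\<close>.  So all increments inherit the sign of the first one.
\<close>

lemma R_CMM_increments_nonneg:
  assumes A: "R_CMM N A"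
    and u: "numerical_solution N A t (\<lambda>_. f) u"
    and lip: "\<And>x y. \<bar>f x - f y\<bar> \<le> M * \<bar>x - y\<bar>"
    and M: "\<And>n. 1 \<le> n \<Longrightarrow> n \<le> N \<Longrightarrow> M * A n 0 < 1"
    and start: "u 0 \<le> u 1"
    and n: "1 \<le> n" "n \<le> N"
  shows "u (n - 1) \<le> u n"
proof -
  obtain C where C: "right_complementary N A C" and nn: "nonneg_kernel N C"
    and column: "column_monotone N C"
    using A by (auto simp: R_CMM_def doubly_monotone_def column_monotone_def)
  define e where "e j = u j - u (j - 1)" for j
  have fu: "f (u n) = (\<Sum>j = 1..n. C n (n - j) * e j)" if "1 \<le> n" "n \<le> N" for n
    unfolding e_def
    using u[unfolded numerical_solution_def, rule_format]
    by (intro volterra_to_difference_form[OF C _ that, of u "\<lambda>j. f (u j)"]) blast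
  have "0 \<le> e n"
    using n
  proof (induction n rule: less_induct)
    case (less n)
    show ?case
    proof (cases "n = 1")
      case True
      then show ?thesis using start by (simp add: e_def)
    next
      case False
      then obtain m where m: "n = Suc m" "1 \<le> m" using less.prems by (cases n) auto
      have "f (u n) - f (u m) = C n 0 * e n - (\<Sum>j = 1..m. (C m (m - j) - C n (n - j)) * e j)"
        using fu[of n] fu[of m] less.prems m by (simp add: left_diff_distrib sum_subtractf)
      moreover have "0 \<le> (\<Sum>j = 1..m. (C m (m - j) - C n (n - j)) * e j)"
      proof (intro sum_nonneg mult_nonneg_nonneg)
        fix j assume j: "j \<in> {1..m}"
        show "0 \<le> C m (m - j) - C n (n - j)"
          using column_monotoneD[OF column, of j m] less.prems m j by auto
        show "0 \<le> e j" using less.IH[of j] less.prems j m by auto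
      qed
      ultimately have "0 \<le> C n 0 * e n - (f (u n) - f (u m))" by simp
      moreover have "\<bar>f (u n) - f (u m)\<bar> \<le> M * \<bar>e n\<bar>"
        using lip m by (simp add: e_def)
      ultimately show ?thesis
        using implicit_step_sign diagonal_dominates[OF C nn less.prems M[OF less.prems]] by blast
    qed
  qed
  then show ?thesis by (simp add: e_def)
qed

lemma mono_on_atMost_if_steps:
  fixes u :: "nat \<Rightarrow> real"
  assumes "\<And>n. 1 \<le> n \<Longrightarrow> n \<le> N \<Longrightarrow> u (n - 1) \<le> u n"
  shows "mono_on {0..N} u"
proof (rule mono_onI)
  fix r s assume "r \<in> {0..N}" "s \<in> {0..N}" and "r \<le> s"
  from this(3,2) show "u r \<le> u s"
  proof (induction s rule: dec_induct)
    case (step s)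
    then show ?case using assms[of "Suc s"] by auto
  qed simp
qed

theorem R_CMM_monotone_solution:
  assumes A: "R_CMM N A"
    and u: "numerical_solution N A t (\<lambda>_. f) u"
    and lip: "\<And>x y. \<bar>f x - f y\<bar> \<le> M * \<bar>x - y\<bar>"
    and M: "\<And>n. 1 \<le> n \<Longrightarrow> n \<le> N \<Longrightarrow> M * A n 0 < 1"
  shows "mono_on {0..N} u \<or> antimono_on {0..N} u"
proof (cases "u 0 \<le> u 1")
  case True
  then have "mono_on {0..N} u"
    using R_CMM_increments_nonneg[OF A u lip M] by (intro mono_on_atMost_if_steps)
  then show ?thesis ..
next
  case False
  \<comment> \<open>The sequence \<open>- u\<close> solves the scheme for the reflected nonlinearity, which has the same
    Lipschitz constant.\<close>
  define f' where "f' x = - f (- x)" for x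
  define v where "v n = - u n" for n
  have v: "numerical_solution N A t (\<lambda>_. f') v"
    unfolding numerical_solution_def
  proof (intro allI impI)
    fix n assume "1 \<le> n \<and> n \<le> N"
    with u have "u n = u 0 + (\<Sum>j = 1..n. A n (n - j) * f (u j))"
      unfolding numerical_solution_def by blast
    then show "v n = v 0 + (\<Sum>j = 1..n. A n (n - j) * f' (v j))"
      unfolding v_def f'_def by (simp only: minus_minus mult_minus_right sum_negf)
  qed
  have lip': "\<bar>f' x - f' y\<bar> \<le> M * \<bar>x - y\<bar>" for x y
    using lip[of "- x" "- y"] by (simp add: f'_def abs_minus_commute)
  have "mono_on {0..N} v"
    using R_CMM_increments_nonneg[OF A v lip' M] False
    by (intro mono_on_atMost_if_steps) (auto simp: v_def)
  then have "antimono_on {0..N} u"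
    by (auto simp: monotone_on_def v_def)
  then show ?thesis ..
qed

section \<open>Increments of a power function\<close>

definition powr_increment :: "real \<Rightarrow> real \<Rightarrow> real \<Rightarrow> real \<Rightarrow> real" where
  "powr_increment \<alpha> p x y = (y - p) powr \<alpha> - (x - p) powr \<alpha>"

lemma continuous_on_powr_shift:
  fixes \<alpha> p x y :: real
  assumes "0 < \<alpha>" "p \<le> x"
  shows "continuous_on {x..y} (\<lambda>s. (s - p) powr \<alpha>)"
  using assms by (intro continuous_on_powr') (auto intro!: continuous_intros)

lemma powr_shift_has_real_derivative:
  fixes \<alpha> p s :: real
  assumes "p < s"
  shows "((\<lambda>s. (s - p) powr \<alpha>) has_real_derivative \<alpha> * (s - p) powr (\<alpha> - 1)) (at s)"
  using assms by (auto intro!: derivative_eq_intros)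

lemma powr_increment_pos:
  assumes "0 < \<alpha>" "p \<le> x" "x < y"
  shows "0 < powr_increment \<alpha> p x y"
  using assms by (simp add: powr_increment_def powr_less_mono2)

text \<open>
  Cauchy's mean value theorem for \<open>(s - p) powr \<alpha>\<close> and \<open>(s - q) powr \<alpha>\<close>.  The case \<open>q = x\<close> occurs
  on the diagonal of the kernel; there the second function has, for \<open>\<alpha> < 1\<close>, a vertical tangent at
  \<open>x\<close>.  So the proof uses only continuity on the closed interval, and applies Rolle's theorem
  to the usual combination \<open>h\<close> of the two functions.
\<close>

lemma powr_increment_quotient:
  assumes "0 < \<alpha>" "p < q" "q \<le> x" "x < y"
  obtains \<xi> where "x < \<xi>" "\<xi> < y"
    "powr_increment \<alpha> p x y = ((\<xi> - p) / (\<xi> - q)) powr (\<alpha> - 1) * powr_increment \<alpha> q x y"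
proof -
  let ?P = "powr_increment \<alpha> p x y" and ?Q = "powr_increment \<alpha> q x y"
  define h where "h s = ?Q * (s - p) powr \<alpha> - ?P * (s - q) powr \<alpha>" for s
  define h' where "h' s = ?Q * (\<alpha> * (s - p) powr (\<alpha> - 1)) - ?P * (\<alpha> * (s - q) powr (\<alpha> - 1))" for s
  have deriv: "DERIV h s :> h' s" if "x < s" for s
    unfolding h_def h'_def using assms that
    by (intro DERIV_diff DERIV_cmult powr_shift_has_real_derivative) auto
  have "continuous_on {x..y} h"
    unfolding h_def using assms
    by (intro continuous_on_diff continuous_on_mult continuous_on_const continuous_on_powr_shift) auto
  then obtain l \<xi> where \<xi>: "x < \<xi>" "\<xi> < y" and l: "DERIV h \<xi> :> l" "h y - h x = (y - x) * l"
    using MVT[of x y h] deriv assms by (auto simp: real_differentiable_def)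
  have "h y - h x = 0"
    by (simp add: h_def powr_increment_def algebra_simps)
  then have "h' \<xi> = 0"
    using l deriv[OF \<xi>(1)] assms by (auto dest: DERIV_unique)
  then have "?Q * (\<xi> - p) powr (\<alpha> - 1) = ?P * (\<xi> - q) powr (\<alpha> - 1)"
    using assms by (simp add: h'_def)
  then have "?P = ((\<xi> - p) / (\<xi> - q)) powr (\<alpha> - 1) * ?Q"
    using assms \<xi> by (simp add: powr_divide field_simps)
  with \<xi> show thesis by (rule that)
qed

lemma powr_increment_antimono:
  assumes "0 < \<alpha>" "\<alpha> < 1" "p < q" "q \<le> x" "x < y"
  shows "powr_increment \<alpha> p x y \<le> powr_increment \<alpha> q x y"
proof -
  obtain \<xi> where \<xi>: "x < \<xi>"
    "powr_increment \<alpha> p x y = ((\<xi> - p) / (\<xi> - q)) powr (\<alpha> - 1) * powr_increment \<alpha> q x y"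
    using powr_increment_quotient assms by metis
  have "((\<xi> - p) / (\<xi> - q)) powr (\<alpha> - 1) \<le> ((\<xi> - p) / (\<xi> - q)) powr 0"
    using assms \<xi> by (intro powr_mono) (auto simp: field_simps)
  then have "((\<xi> - p) / (\<xi> - q)) powr (\<alpha> - 1) \<le> 1"
    using assms \<xi> by simp
  then show ?thesis
    using \<xi> powr_increment_pos[of \<alpha> q x y] assms by (simp add: mult_le_cancel_right1)
qed

text \<open>
  By the mean value theorem, the quotient of the increments with base points \<open>p\<close> and \<open>q\<close> is
  \<open>((\<xi> - p) / (\<xi> - q)) powr (\<alpha> - 1)\<close> at an intermediate point \<open>\<xi>\<close>.  The base of this power decreases
  to \<open>1\<close> as \<open>\<xi>\<close> grows, and its exponent is negative, so the quotient is larger on the later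
  interval.
\<close>

lemma powr_increment_cross:
  assumes "0 < \<alpha>" "\<alpha> < 1" "p < q" "q \<le> x" "x < y" "y < z"
  shows "powr_increment \<alpha> p x y * powr_increment \<alpha> q y z
    \<le> powr_increment \<alpha> p y z * powr_increment \<alpha> q x y"
proof -
  let ?r = "\<lambda>\<xi>. ((\<xi> - p) / (\<xi> - q)) powr (\<alpha> - 1)"
  obtain \<xi> where \<xi>: "x < \<xi>" "\<xi> < y" "powr_increment \<alpha> p x y = ?r \<xi> * powr_increment \<alpha> q x y"
    using powr_increment_quotient[of \<alpha> p q x y] assms by blast
  obtain \<eta> where \<eta>: "y < \<eta>" "powr_increment \<alpha> p y z = ?r \<eta> * powr_increment \<alpha> q y z"
    using powr_increment_quotient[of \<alpha> p q y z] assms by auto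
  \<comment> \<open>Both fractions are \<open>1 + (q - p) / (s - q)\<close>, at \<open>s = \<eta>\<close> and at the earlier point \<open>s = \<xi>\<close>.\<close>
  have "(\<eta> - p) / (\<eta> - q) \<le> (\<xi> - p) / (\<xi> - q)"
  proof -
    have "(\<eta> - \<xi>) * p \<le> (\<eta> - \<xi>) * q"
      using assms \<xi> \<eta> by (intro mult_left_mono) auto
    then have "(\<eta> - p) * (\<xi> - q) \<le> (\<xi> - p) * (\<eta> - q)"
      by (simp add: algebra_simps)
    then show ?thesis using assms \<xi> \<eta> by (simp add: divide_le_eq field_simps)
  qed
  then have "?r \<xi> \<le> ?r \<eta>"
    using assms \<xi> \<eta> by (intro powr_mono2') auto
  then show ?thesis
    using \<xi> \<eta> powr_increment_pos[of \<alpha> q x y] powr_increment_pos[of \<alpha> q y z] assms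
    by (simp add: mult_right_mono mult_ac)
qed

text \<open>
  The time reflection \<open>s \<mapsto> - s\<close> puts the base point to the left of the interval.  Then the entries
  of the kernel, whose integration variable is the earlier time, and the entries of its row
  difference matrix, where the later time varies, are covered by the same inequalities.
\<close>

lemma integral_powr_kernel:
  assumes "0 < \<alpha>" "a \<le> b" "b \<le> (\<tau> :: real)"
  shows "integral {a..b} (\<lambda>s. (\<tau> - s) powr (\<alpha> - 1)) = powr_increment \<alpha> (- \<tau>) (- b) (- a) / \<alpha>"
proof -
  let ?G = "\<lambda>s. - ((\<tau> - s) powr \<alpha> / \<alpha>)"
  have "((\<lambda>s. (\<tau> - s) powr (\<alpha> - 1)) has_integral (?G b - ?G a)) {a..b}"
  proof (rule fundamental_theorem_of_calculus_interior[OF assms(2)])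
    show "continuous_on {a..b} ?G"
      using assms by (intro continuous_intros continuous_on_powr') auto
    show "(?G has_vector_derivative (\<tau> - s) powr (\<alpha> - 1)) (at s)" if "s \<in> {a<..<b}" for s
      unfolding has_real_derivative_iff_has_vector_derivative[symmetric]
      using that assms by (auto intro!: derivative_eq_intros)
  qed
  then show ?thesis
    by (simp add: integral_unique powr_increment_def diff_divide_distrib)
qed

section \<open>The fractional integral kernel\<close>

text \<open>
  The three properties that the criterion asks for come from the increment lemmas: column
  monotonicity and the quotient condition for \<open>A\<close> with the reflected grid, and the quotient
  condition for \<open>W\<close> with the grid itself.
\<close>

lemma fractional_kernel_R_CMM:
  assumes \<alpha>: "0 < \<alpha>" "\<alpha> < 1" and \<kappa>: "0 < \<kappa>"
    and grid: "\<And>i j. i < j \<Longrightarrow> j \<le> N \<Longrightarrow> t i < t j"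
    and A: "\<And>n j. 1 \<le> j \<Longrightarrow> j \<le> n \<Longrightarrow> n \<le> N \<Longrightarrow>
      A n (n - j) = \<kappa> * powr_increment \<alpha> (- t n) (- t j) (- t (j - 1))"
  shows "R_CMM N A"
proof -
  have grid': "t i \<le> t j" if "i \<le> j" "j \<le> N" for i j
    using grid[of i j] that by (cases "i = j") auto
  have pos: "0 < A n (n - j)" if "1 \<le> j" "j \<le> n" "n \<le> N" for n j
    using A[OF that] grid[of "j - 1" j] grid'[of j n] that \<alpha> \<kappa>
    by (simp add: powr_increment_pos)
  have col: "A (Suc n) (Suc n - j) \<le> A n (n - j)" if "1 \<le> j" "j \<le> n" "n < N" for n j
    using A[of j n] A[of j "Suc n"] grid[of "j - 1" j] grid[of n "Suc n"] grid'[of j n] that \<alpha> \<kappa>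
    by (simp add: powr_increment_antimono)
  have tail: "(\<Sum>i = j..n. A n (n - i)) = \<kappa> * (t n - t (j - 1)) powr \<alpha>"
    if "1 \<le> j" "j \<le> Suc n" "n \<le> N" for n j
  proof -
    have "(\<Sum>i = j..n. A n (n - i)) = (\<Sum>i = j..n. \<kappa> * (t n - t (i - 1)) powr \<alpha> - \<kappa> * (t n - t i) powr \<alpha>)"
      using that by (intro sum.cong) (auto simp: A powr_increment_def algebra_simps)
    also have "\<dots> = \<kappa> * (t n - t (j - 1)) powr \<alpha>"
      using that(2) by (induction j rule: inc_induct) (auto simp: sum.atLeast_Suc_atMost)
    finally show ?thesis .
  qed
  define W where "W n j = (\<Sum>i = j..n. A n (n - i)) - (\<Sum>i = j..n - 1. A (n - 1) (n - 1 - i))" for n j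
  \<comment> \<open>This includes \<open>j = n\<close>, since the increment from the base point \<open>t (n - 1)\<close> itself starts at
    the value \<open>0 powr \<alpha> = 0\<close>.\<close>
  have W: "W n j = \<kappa> * powr_increment \<alpha> (t (j - 1)) (t (n - 1)) (t n)"
    if "1 \<le> j" "j \<le> n" "n \<le> N" for n j
    using tail[of j n] tail[of j "n - 1"] that
    by (simp add: W_def powr_increment_def algebra_simps)
  show ?thesis
  proof (rule R_CMM_if_log_convex)
    have "A n j \<le> A (n - 1) (j - 1)" if "n \<le> N" "1 \<le> j" "j \<le> n - 1" for n j
      using col[of "n - j" "n - 1"] that by (simp add: diff_diff_eq Suc_diff_le)
    then show "column_monotone N A"
      using pos by (auto simp: column_monotone_def nonneg_kernel_def less_imp_le)
    show "A (Suc n) (n - j) * A n (n - j) \<le> A (Suc n) (Suc n - j) * A n (n - Suc j)"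
      if "1 \<le> j" "j < n" "n < N" for n j
    proof -
      have "powr_increment \<alpha> (- t (Suc n)) (- t (Suc j)) (- t j) * powr_increment \<alpha> (- t n) (- t j) (- t (j - 1))
          \<le> powr_increment \<alpha> (- t (Suc n)) (- t j) (- t (j - 1)) * powr_increment \<alpha> (- t n) (- t (Suc j)) (- t j)"
        using that grid[of n "Suc n"] grid'[of "Suc j" n] grid[of j "Suc j"] grid[of "j - 1" j] \<alpha>
        by (intro powr_increment_cross) auto
      then show ?thesis
        using A[of "Suc j" "Suc n"] A[of j n] A[of j "Suc n"] A[of "Suc j" n] that \<kappa>
        by (simp add: mult_ac)
    qed
    show "0 < W n j" if "1 \<le> j" "j \<le> n" "n \<le> N" for n j
      using W[OF that] grid'[of "j - 1" "n - 1"] grid[of "n - 1" n] that \<alpha> \<kappa>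
      by (simp add: powr_increment_pos)
    show "W (Suc n) (Suc j) * W n j \<le> W (Suc n) j * W n (Suc j)"
      if "1 \<le> j" "j < n" "n < N" for n j
    proof -
      have "powr_increment \<alpha> (t (j - 1)) (t (n - 1)) (t n) * powr_increment \<alpha> (t j) (t n) (t (Suc n))
          \<le> powr_increment \<alpha> (t (j - 1)) (t n) (t (Suc n)) * powr_increment \<alpha> (t j) (t (n - 1)) (t n)"
        using that grid[of n "Suc n"] grid[of "n - 1" n] grid'[of j "n - 1"] grid[of "j - 1" j] \<alpha>
        by (intro powr_increment_cross) auto
      then show ?thesis
        using that \<kappa> by (simp add: W mult_ac)
    qed
  qed (rule pos W_def; assumption)+
qed

lemma smooth_on_deriv_bound_lipschitz:
  fixes f :: "real \<Rightarrow> real"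
  assumes "smooth_on f UNIV" and "\<And>x. \<bar>deriv f x\<bar> \<le> M"
  shows "\<bar>f x - f y\<bar> \<le> M * \<bar>x - y\<bar>"
proof -
  have "Ck_on (Suc 0) f UNIV"
    using assms(1) unfolding smooth_on_def ..
  then have "f differentiable at x" for x
    by (auto simp: differentiable_def)
  then have "(f has_field_derivative deriv f x) (at x within UNIV)" for x
    by (simp add: DERIV_deriv_iff_real_differentiable)
  then show ?thesis
    using field_differentiable_bound[of UNIV f "deriv f" M x y] assms(2) by simp
qed

theorem proposition6p1:
  fixes \<alpha> T :: real and N :: nat and t :: "nat \<Rightarrow> real" and A :: array_kernel
  assumes alpha: "0 < \<alpha>" "\<alpha> < 1"
    and N: "1 \<le> N"
    and grid: "t 0 = 0" "\<forall>n<N. t n < t (Suc n)" "t N = T"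
    and A: "\<forall>n j. 1 \<le> j \<and> j \<le> n \<and> n \<le> N \<longrightarrow>
      A n (n - j) = 1 / Gamma \<alpha> * integral {t (j - 1)..t j} (\<lambda>s. (t n - s) powr (\<alpha> - 1))"
  shows "R_CMM N A \<and>
    (\<forall>(f :: real \<Rightarrow> real \<Rightarrow> real) M u v.
      smooth_on (\<lambda>(t, x). f t x) ({0..} \<times> UNIV) \<and>
      M > 0 \<and> (\<forall>t\<in>{0..T}. M-lipschitz_on UNIV (f t)) \<and>
      M * (SUP j\<in>{1..N}. A j 0) < 1 \<and>
      numerical_solution N A t f u \<and> numerical_solution N A t f v \<and> u 0 \<ge> v 0
      \<longrightarrow> (\<forall>n\<le>N. u n \<ge> v n)) \<and>
    (\<forall>(f :: real \<Rightarrow> real) M u.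
      smooth_on f UNIV \<and>
      M > 0 \<and> (\<forall>x. \<bar>deriv f x\<bar> \<le> M) \<and>
      M * (SUP j\<in>{1..N}. A j 0) < 1 \<and>
      numerical_solution N A t (\<lambda>_. f) u
      \<longrightarrow> mono_on {0..N} u \<or> antimono_on {0..N} u)"
proof -
  have grid_less: "t i < t j" if "i < j" "j \<le> N" for i j
    using that
  proof (induction j)
    case (Suc j)
    then show ?case using grid(2)[rule_format, of j] by (cases "i = j") auto
  qed simp
  have "A n (n - j) = 1 / (\<alpha> * Gamma \<alpha>) * powr_increment \<alpha> (- t n) (- t j) (- t (j - 1))"
    if j: "1 \<le> j" "j \<le> n" "n \<le> N" for n j
  proof -
    have "t (j - 1) \<le> t j" "t j \<le> t n"
      using grid_less[of "j - 1" j] grid_less[of j n] j by (cases "j = n"; simp)+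
    then show ?thesis
      using A[rule_format, of j n] j alpha by (simp add: integral_powr_kernel)
  qed
  then have R: "R_CMM N A"
    using alpha grid_less by (intro fractional_kernel_R_CMM[of \<alpha> "1 / (\<alpha> * Gamma \<alpha>)" N t]) (auto simp: Gamma_real_pos)
  have diag: "M * A n 0 < 1"
    if "M > 0" "M * (SUP j\<in>{1..N}. A j 0) < 1" "1 \<le> n" "n \<le> N" for M :: real and n
  proof -
    have "A n 0 \<le> (SUP j\<in>{1..N}. A j 0)"
      using that by (intro cSUP_upper bdd_above_finite) auto
    then have "M * A n 0 \<le> M * (SUP j\<in>{1..N}. A j 0)"
      using that by (intro mult_left_mono) auto
    then show ?thesis using that by linarith
  qed
  have in_range: "t n \<in> {0..T}" if "n \<le> N" for n
    using grid_less[of 0 n] grid_less[of n N] grid that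
    by (cases "n = 0"; cases "n = N") auto
  show ?thesis
  proof (intro conjI allI impI R; elim conjE)
    fix f :: "real \<Rightarrow> real \<Rightarrow> real" and M u v n
    assume "0 < M" "M * (SUP j\<in>{1..N}. A j 0) < 1"
      and lip: "\<forall>t\<in>{0..T}. M-lipschitz_on UNIV (f t)"
      and sol: "numerical_solution N A t f u" "numerical_solution N A t f v"
      and "v 0 \<le> u 0" "n \<le> N"
    have "\<bar>f (t n) x - f (t n) y\<bar> \<le> M * \<bar>x - y\<bar>" if "1 \<le> n" "n \<le> N" for n x y
      using lip in_range[OF that(2)] lipschitz_onD[of M UNIV "f (t n)" x y]
      by (auto simp: dist_real_def)
    then show "v n \<le> u n"
      using R_CMM_comparison[OF R sol \<open>v 0 \<le> u 0\<close> _ diag \<open>n \<le> N\<close>]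
        \<open>0 < M\<close> \<open>M * (SUP j\<in>{1..N}. A j 0) < 1\<close> by blast
  next
    fix f :: "real \<Rightarrow> real" and M u
    assume "smooth_on f UNIV" "\<forall>x. \<bar>deriv f x\<bar> \<le> M"
      and "0 < M" "M * (SUP j\<in>{1..N}. A j 0) < 1"
      and sol: "numerical_solution N A t (\<lambda>_. f) u"
    then show "mono_on {0..N} u \<or> antimono_on {0..N} u"
      using R_CMM_monotone_solution[OF R sol] smooth_on_deriv_bound_lipschitz diag by blast
  qed
qed

end
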